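(* For $n \geq 5$, the Kneser graph $K(n,2)$ satisfies $\mathrm{tp}(K(n,2)) = \mathrm{tp}^-(K(n,2)) = 6$ if $n = 5$, and $\mathrm{tp}(K(n,2)) = \mathrm{tp}^-(K(n,2)) = \lfloor n/2 \rfloor$ if $n \geq 6$.
   Context: The Kneser graph $K(n,2)$ has as vertices the 2-element subsets of $\{1,\dots,n\}$, two being adjacent iff they are disjoint. A set $S \subseteq V(G)$ is in general position if no shortest path of $G$ contains three vertices of $S$. A terminal set of $G$ is a general position set $S$ that is maximal under inclusion and such that for every $u \in V(G)\setminus S$ there is a shortest path of $G$ with $u$ as an endpoint containing at least two vertices of $S$. $\mathrm{tp}(G)$ and $\mathrm{tp}^-(G)$ are the orders of a largest and a smallest terminal set of $G$, respectively. *)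

theory Defs
  imports "Graph_Theory.Graph_Theory"
begin

text \<open>As in the Graph_Theory entry, a simple graph is a symmetric loop-free digraph.\<close>

definition kneser :: "nat \<Rightarrow> nat \<Rightarrow> nat set pair_pre_digraph" where
  "kneser n k =
     (let V = {A. A \<subseteq> {1..n} \<and> card A = k}
      in \<lparr> pverts = V, parcs = {(A, B) \<in> V \<times> V. A \<inter> B = {}} \<rparr>)"

text \<open>For k = 0 the empty set would carry a loop, hence the hypothesis.\<close>

lemma pair_graph_kneser:
  assumes "k \<ge> 1"
  shows "pair_graph (kneser n k)"
proof -
  let ?V = "{A. A \<subseteq> {1..n} \<and> card A = k}"
  have V: "finite ?V"
    by (rule finite_subset[of _ "Pow {1..n}"]) auto
  have pv: "pverts (kneser n k) = ?V"
    and pa: "parcs (kneser n k) = {(A, B) \<in> ?V \<times> ?V. A \<inter> B = {}}"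
    by (simp_all add: kneser_def Let_def)
  have E: "finite (parcs (kneser n k))"
    by (rule finite_subset[OF _ finite_cartesian_product[OF V V]]) (auto simp: pa)
  have sym: "symmetric (with_proj (kneser n k))"
    unfolding symmetric_def sym_def with_proj_simps pa by blast
  have loop: "fst e \<noteq> snd e" if e: "e \<in> parcs (kneser n k)" for e
  proof -
    obtain A B where AB: "e = (A, B)" by (cases e)
    with e have "card A = k" "A \<inter> B = {}" unfolding pa by blast+
    with assms have "A \<noteq> B" by (metis Int_absorb card.empty not_one_le_zero)
    with AB show ?thesis by simp
  qed
  show ?thesis
  proof
    show "fst e \<in> pverts (kneser n k)" "snd e \<in> pverts (kneser n k)"
      if "e \<in> parcs (kneser n k)" for e
      using that unfolding pv pa by auto
    show "finite (pverts (kneser n k))"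
      using V unfolding pv .
  qed (fact E sym loop)+
qed

text \<open>Paths are given by their nonempty vertex lists; a single vertex is a path of length 0.\<close>

definition shortest_path :: "('a, 'b) pre_digraph \<Rightarrow> 'a list \<Rightarrow> bool" where
  "shortest_path G p \<longleftrightarrow> vpath p G \<and>
     (\<forall>q. vpath q G \<and> hd q = hd p \<and> last q = last p \<longrightarrow> vwalk_length p \<le> vwalk_length q)"

definition general_position :: "('a, 'b) pre_digraph \<Rightarrow> 'a set \<Rightarrow> bool" where
  "general_position G S \<longleftrightarrow> S \<subseteq> verts G \<and>
     \<not> (\<exists>p. shortest_path G p \<and> card (set p \<inter> S) \<ge> 3)"

definition terminal_set :: "('a, 'b) pre_digraph \<Rightarrow> 'a set \<Rightarrow> bool" where
  "terminal_set G S \<longleftrightarrow> general_position G S \<and>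
     \<not> (\<exists>T. general_position G T \<and> S \<subset> T) \<and>
     (\<forall>u \<in> verts G - S. \<exists>p. shortest_path G p \<and> (hd p = u \<or> last p = u) \<and>
        card (set p \<inter> S) \<ge> 2)"

text \<open>If a graph has no terminal set, these two numbers are unspecified.\<close>

definition tp :: "('a, 'b) pre_digraph \<Rightarrow> nat" where
  "tp G = Max {card S | S. terminal_set G S}"

definition tp_minus :: "('a, 'b) pre_digraph \<Rightarrow> nat" where
  "tp_minus G = Min {card S | S. terminal_set G S}"

end

theory Submission
  imports Defs
begin

text \<open>
  For \<open>n \<ge> 5\<close> the graph \<open>K(n,2)\<close> has diameter 2, so only induced paths on three vertices matter:
  \<open>S\<close> is in general position iff disjointness is transitive on distinct members of \<open>S\<close>, and a
  terminal set must moreover contain, for every pair \<open>u \<notin> S\<close>, two disjoint members of which \<open>u\<close>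
  meets exactly one. A general position set containing disjoint pairs \<open>A\<close>, \<open>B\<close> is either a
  matching or lives inside \<open>A \<union> B\<close>, since a pair meeting \<open>A\<close> must also meet every member disjoint
  from \<open>A\<close>. If \<open>n \<ge> 6\<close>, a pair disjoint from all of \<open>S\<close> rules out everything but matchings leaving
  at most one point uncovered. If \<open>n = 5\<close>, a missing pair inside \<open>A \<union> B\<close> is disjoint only from its
  complement, so \<open>S\<close> consists of all six pairs in \<open>A \<union> B\<close>.
\<close>

section \<open>Shortest paths with at most three vertices in an arbitrary digraph\<close>

lemma vpath_singleton_iff: "vpath [a] G \<longleftrightarrow> a \<in> verts G"
  by (auto simp: vpath_def vwalk_def)

text \<open>Between distinct ends, the only possible shortcut of a path with two arcs is a single
  arc; so these are the induced paths, up to the direction of arcs.\<close>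

lemma shortest_path_3_iff:
  "shortest_path G [a, b, c] \<longleftrightarrow>
     {a, b, c} \<subseteq> verts G \<and> distinct [a, b, c] \<and> a \<rightarrow>\<^bsub>G\<^esub> b \<and> b \<rightarrow>\<^bsub>G\<^esub> c \<and> \<not> a \<rightarrow>\<^bsub>G\<^esub> c"
proof
  assume sp: "shortest_path G [a, b, c]"
  then have v: "{a, b, c} \<subseteq> verts G" "distinct [a, b, c]" "a \<rightarrow>\<^bsub>G\<^esub> b" "b \<rightarrow>\<^bsub>G\<^esub> c"
    by (auto simp: shortest_path_def vpath_def vwalk_def)
  have "\<not> a \<rightarrow>\<^bsub>G\<^esub> c"
  proof
    assume "a \<rightarrow>\<^bsub>G\<^esub> c"
    with v have "vpath [a, c] G" by (auto simp: vpath_def vwalk_def)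
    with sp show False by (auto simp: shortest_path_def dest!: spec[of _ "[a, c]"])
  qed
  with v show "{a, b, c} \<subseteq> verts G \<and> distinct [a, b, c] \<and> a \<rightarrow>\<^bsub>G\<^esub> b \<and> b \<rightarrow>\<^bsub>G\<^esub> c \<and> \<not> a \<rightarrow>\<^bsub>G\<^esub> c"
    by blast
next
  assume v: "{a, b, c} \<subseteq> verts G \<and> distinct [a, b, c] \<and> a \<rightarrow>\<^bsub>G\<^esub> b \<and> b \<rightarrow>\<^bsub>G\<^esub> c \<and> \<not> a \<rightarrow>\<^bsub>G\<^esub> c"
  have "2 \<le> vwalk_length q" if q: "vpath q G" "hd q = a" "last q = c" for q
  proof (rule ccontr)
    assume "\<not> 2 \<le> vwalk_length q"
    moreover have "q \<noteq> []" using q by (auto simp: vpath_def vwalk_def)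
    ultimately consider x where "q = [x]" | x y where "q = [x, y]"
      by (cases q; cases "tl q"; cases "tl (tl q)") auto
    \<comment> \<open>One vertex would force \<open>a = c\<close>, two vertices an arc from
      \<open>a\<close> to \<open>c\<close>.\<close>
    then show False using q v by cases (auto simp: vpath_def vwalk_def)
  qed
  moreover have "vpath [a, b, c] G" using v by (auto simp: vpath_def vwalk_def)
  ultimately show "shortest_path G [a, b, c]" by (simp add: shortest_path_def numeral_2_eq_2)
qed

text \<open>\<open>length\<close> counts vertices, so the bound 3 expresses diameter at most
  2.\<close>

lemma shortest_path_length_le_3:
  assumes sp: "shortest_path G p"
    and diam: "\<And>a c. a \<in> verts G \<Longrightarrow> c \<in> verts G \<Longrightarrow> a \<noteq> c \<Longrightarrow> \<not> a \<rightarrow>\<^bsub>G\<^esub> c \<Longrightarrow>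
      \<exists>b. b \<in> verts G \<and> b \<noteq> a \<and> b \<noteq> c \<and> a \<rightarrow>\<^bsub>G\<^esub> b \<and> b \<rightarrow>\<^bsub>G\<^esub> c"
  shows "length p \<le> 3"
proof -
  let ?a = "hd p" and ?c = "last p"
  have "p \<noteq> []" "set p \<subseteq> verts G" using sp by (auto simp: shortest_path_def vpath_def vwalk_def)
  then have ac: "?a \<in> verts G" "?c \<in> verts G" by auto
  have "\<exists>q. vpath q G \<and> hd q = ?a \<and> last q = ?c \<and> length q \<le> 3"
  proof -
    consider "?a = ?c" | "?a \<noteq> ?c" "?a \<rightarrow>\<^bsub>G\<^esub> ?c" | "?a \<noteq> ?c" "\<not> ?a \<rightarrow>\<^bsub>G\<^esub> ?c" by blast
    then show ?thesis
    proof cases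
      case 1
      with ac show ?thesis by (intro exI[of _ "[?a]"]) (auto simp: vpath_singleton_iff)
    next
      case 2
      with ac show ?thesis by (intro exI[of _ "[?a, ?c]"]) (auto simp: vpath_def vwalk_def)
    next
      case 3
      with diam[OF ac] obtain b where "b \<in> verts G" "b \<noteq> ?a" "b \<noteq> ?c" "?a \<rightarrow>\<^bsub>G\<^esub> b" "b \<rightarrow>\<^bsub>G\<^esub> ?c"
        by blast
      with ac 3 show ?thesis by (intro exI[of _ "[?a, b, ?c]"]) (auto simp: vpath_def vwalk_def)
    qed
  qed
  then obtain q where "vpath q G" "hd q = ?a" "last q = ?c" "length q \<le> 3" by blast
  with sp have "vwalk_length p \<le> vwalk_length q" unfolding shortest_path_def by blast
  with \<open>length q \<le> 3\<close> show ?thesis by simp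
qed

text \<open>Three hits on at most three entries leave no room for a repetition or for a vertex
  outside \<open>S\<close>.\<close>

lemma list_eq_3_if_card_set_ge_3:
  assumes "length p \<le> 3" "3 \<le> card (set p \<inter> S)"
  obtains a b c where "p = [a, b, c]" "{a, b, c} \<subseteq> S"
proof -
  have le: "card (set p \<inter> S) \<le> card (set p)" by (simp add: card_mono)
  have "length p = 3" using assms le card_length[of p] by linarith
  then obtain a b c where p: "p = [a, b, c]" by (auto simp: numeral_3_eq_3 length_Suc_conv)
  have "set p \<inter> S = set p"
    using assms card_length[of p] by (intro card_seteq) auto
  with p that show thesis by (simp add: Int_absorb2) blast
qed

section \<open>Adjacency and diameter of \<open>kneser n 2\<close>\<close>

lemma pverts_kneser: "pverts (kneser n k) = {A. A \<subseteq> {1..n} \<and> card A = k}"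
  by (simp add: kneser_def Let_def)

lemma adj_kneser_iff:
  "A \<rightarrow>\<^bsub>with_proj (kneser n k)\<^esub> B \<longleftrightarrow>
     A \<in> pverts (kneser n k) \<and> B \<in> pverts (kneser n k) \<and> A \<inter> B = {}"
  by (auto simp: kneser_def Let_def arcs_ends_conv)


text \<open>Two pairs that meet cover at most three points, so \<open>5 \<le> n\<close> leaves two
  points for a pair disjoint from both.\<close>

lemma kneser_2_common_neighbour:
  assumes "5 \<le> n" "A \<in> pverts (kneser n 2)" "C \<in> pverts (kneser n 2)" "A \<inter> C \<noteq> {}"
  obtains B where "B \<in> pverts (kneser n 2)" "A \<inter> B = {}" "B \<inter> C = {}"
proof -
  have A: "A \<subseteq> {1..n}" "card A = 2" and C: "C \<subseteq> {1..n}" "card C = 2"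
    using assms by (auto simp: pverts_kneser)
  then have fin: "finite A" "finite C" by (auto intro: finite_subset)
  have "card (A \<inter> C) \<ge> 1" using assms(4) fin by (simp add: Suc_le_eq card_gt_0_iff)
  then have "card (A \<union> C) \<le> 3" using card_Un_Int[OF fin] A C by linarith
  moreover have "card ({1..n} - (A \<union> C)) = n - card (A \<union> C)"
    using A C fin by (subst card_Diff_subset) auto
  ultimately have "2 \<le> card ({1..n} - (A \<union> C))" using assms(1) by linarith
  then obtain B where "B \<subseteq> {1..n} - (A \<union> C)" "card B = 2" by (rule obtain_subset_with_card_n)
  then show thesis by (intro that[of B]) (auto simp: pverts_kneser)
qed

lemma shortest_path_kneser_2_length_le_3:
  assumes "5 \<le> n" "shortest_path (with_proj (kneser n 2)) p"
  shows "length p \<le> 3"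
proof (rule shortest_path_length_le_3[OF assms(2)])
  fix A C
  assume AC: "A \<in> verts (with_proj (kneser n 2))" "C \<in> verts (with_proj (kneser n 2))"
    "A \<noteq> C" "\<not> A \<rightarrow>\<^bsub>with_proj (kneser n 2)\<^esub> C"
  then have "A \<inter> C \<noteq> {}" unfolding adj_kneser_iff by simp
  with AC assms(1) obtain B where B: "B \<in> pverts (kneser n 2)" "A \<inter> B = {}" "B \<inter> C = {}"
    using kneser_2_common_neighbour by (metis with_proj_simps(1))
  \<comment> \<open>Nonemptiness turns disjointness from \<open>A\<close> and \<open>C\<close> into
    inequality.\<close>
  then have "B \<noteq> {}" by (auto simp: pverts_kneser)
  with B AC show "\<exists>B. B \<in> verts (with_proj (kneser n 2)) \<and> B \<noteq> A \<and> B \<noteq> C \<and>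
      A \<rightarrow>\<^bsub>with_proj (kneser n 2)\<^esub> B \<and> B \<rightarrow>\<^bsub>with_proj (kneser n 2)\<^esub> C"
    unfolding adj_kneser_iff by (intro exI[of _ B]) auto
qed

lemma shortest_path_3_kneser_2_iff:
  "shortest_path (with_proj (kneser n 2)) [A, B, C] \<longleftrightarrow>
     {A, B, C} \<subseteq> pverts (kneser n 2) \<and> A \<noteq> C \<and> A \<inter> B = {} \<and> B \<inter> C = {} \<and> A \<inter> C \<noteq> {}"
proof -
  have "X \<noteq> {}" if "X \<in> pverts (kneser n 2)" for X
    using that by (auto simp: pverts_kneser)
  then show ?thesis unfolding shortest_path_3_iff adj_kneser_iff by auto
qed

section \<open>General position and terminal sets in terms of disjoint pairs\<close>

text \<open>Shortest paths have at most three vertices, so a violation is a whole path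
  \<open>[A, B, C]\<close> inside \<open>S\<close>, with \<open>B\<close> in the middle.\<close>

lemma general_position_kneser_2_iff:
  assumes "5 \<le> n"
  shows "general_position (with_proj (kneser n 2)) S \<longleftrightarrow> S \<subseteq> pverts (kneser n 2) \<and>
    (\<forall>A\<in>S. \<forall>B\<in>S. \<forall>C\<in>S. A \<inter> B = {} \<longrightarrow> B \<inter> C = {} \<longrightarrow> A \<inter> C \<noteq> {} \<longrightarrow> A = C)"
    (is "?gp \<longleftrightarrow> ?sub \<and> ?free")
proof
  assume gp: ?gp
  then have sub: ?sub by (simp add: general_position_def)
  have "A = C" if S: "A \<in> S" "B \<in> S" "C \<in> S" and "A \<inter> B = {}" "B \<inter> C = {}" "A \<inter> C \<noteq> {}" for A B C
  proof (rule ccontr)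
    assume "A \<noteq> C"
    with that sub have sp: "shortest_path (with_proj (kneser n 2)) [A, B, C]"
      unfolding shortest_path_3_kneser_2_iff by blast
    then have "distinct [A, B, C]" unfolding shortest_path_3_iff by blast
    then have "card (set [A, B, C]) = 3" by (simp only: distinct_card) simp
    moreover have "set [A, B, C] \<inter> S = set [A, B, C]" using S by auto
    ultimately show False using gp sp unfolding general_position_def by (metis order_refl)
  qed
  with sub show "?sub \<and> ?free" by blast
next
  assume r: "?sub \<and> ?free"
  have False if "shortest_path (with_proj (kneser n 2)) p" "3 \<le> card (set p \<inter> S)" for p
  proof -
    from list_eq_3_if_card_set_ge_3[OF shortest_path_kneser_2_length_le_3[OF assms that(1)] that(2)]
    obtain A B C where p: "p = [A, B, C]" and S: "{A, B, C} \<subseteq> S" .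
    from that(1) p have "A \<noteq> C" "A \<inter> B = {}" "B \<inter> C = {}" "A \<inter> C \<noteq> {}"
      by (simp_all add: shortest_path_3_kneser_2_iff)
    with r[THEN conjunct2, rule_format, of A B C] S show False by simp
  qed
  with r show ?gp by (auto simp: general_position_def)
qed

text \<open>A path that starts or ends at \<open>U\<close> and has two vertices in \<open>S\<close>
  must be \<open>U\<close>, \<open>A\<close>, \<open>B\<close> up to reversal: \<open>A\<close> is
  the middle vertex and \<open>B\<close> the far end.\<close>

lemma shortest_path_from_iff_kneser_2:
  assumes "5 \<le> n" "S \<subseteq> pverts (kneser n 2)" "U \<in> pverts (kneser n 2) - S"
  shows "(\<exists>p. shortest_path (with_proj (kneser n 2)) p \<and> (hd p = U \<or> last p = U) \<and>
            2 \<le> card (set p \<inter> S)) \<longleftrightarrow>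
         (\<exists>A\<in>S. \<exists>B\<in>S. U \<inter> A = {} \<and> A \<inter> B = {} \<and> U \<inter> B \<noteq> {})"
proof
  assume "\<exists>p. shortest_path (with_proj (kneser n 2)) p \<and> (hd p = U \<or> last p = U) \<and>
            2 \<le> card (set p \<inter> S)"
  then obtain p where p: "shortest_path (with_proj (kneser n 2)) p" "hd p = U \<or> last p = U"
    and c: "2 \<le> card (set p \<inter> S)" by blast
  have ne: "p \<noteq> []" using c by auto
  have "U \<in> set p" using ne p(2) by auto
  \<comment> \<open>Counting \<open>U\<close> as well raises two hits to three, so the whole path
    lies in \<open>insert U S\<close>.\<close>
  then have "card (set p \<inter> insert U S) = Suc (card (set p \<inter> S))"
    using assms(3) by (simp add: Int_insert_right)
  with c have "3 \<le> card (set p \<inter> insert U S)" by simp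
  from list_eq_3_if_card_set_ge_3[OF shortest_path_kneser_2_length_le_3[OF assms(1) p(1)] this]
  obtain X Y Z where q: "p = [X, Y, Z]" "{X, Y, Z} \<subseteq> insert U S" .
  with p(1) have sp: "X \<noteq> Z" "X \<inter> Y = {}" "Y \<inter> Z = {}" "X \<inter> Z \<noteq> {}" 
    by (simp_all add: shortest_path_3_kneser_2_iff)
  from p(1) q have dist: "distinct [X, Y, Z]" by (simp only: shortest_path_3_iff)
  from p(2) q have "X = U \<or> Z = U" by simp
  then show "\<exists>A\<in>S. \<exists>B\<in>S. U \<inter> A = {} \<and> A \<inter> B = {} \<and> U \<inter> B \<noteq> {}"
  proof
    assume "X = U"
    then show ?thesis using sp dist q by (intro bexI[of _ Y] bexI[of _ Z]) auto
  next
    assume "Z = U"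
    then show ?thesis using sp dist q by (intro bexI[of _ Y] bexI[of _ X]) auto
  qed
next
  assume "\<exists>A\<in>S. \<exists>B\<in>S. U \<inter> A = {} \<and> A \<inter> B = {} \<and> U \<inter> B \<noteq> {}"
  then obtain A B where AB: "A \<in> S" "B \<in> S" "U \<inter> A = {}" "A \<inter> B = {}" "U \<inter> B \<noteq> {}" by blast
  then have "shortest_path (with_proj (kneser n 2)) [U, A, B]"
    using assms by (auto simp: shortest_path_3_kneser_2_iff)
  moreover have "set [U, A, B] \<inter> S = {A, B}" using AB assms by auto
  moreover have "A \<noteq> B" using AB by auto
  ultimately show "\<exists>p. shortest_path (with_proj (kneser n 2)) p \<and> (hd p = U \<or> last p = U) \<and>
            2 \<le> card (set p \<inter> S)"
    by (intro exI[of _ "[U, A, B]"]) (simp only:, simp)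
qed

text \<open>Maximality is absorbed: a vertex reached by the third clause together with its two
  witnesses in \<open>S\<close> would break general position.\<close>

lemma terminal_set_kneser_2_iff:
  assumes "5 \<le> n"
  shows "terminal_set (with_proj (kneser n 2)) S \<longleftrightarrow> S \<subseteq> pverts (kneser n 2) \<and>
    (\<forall>A\<in>S. \<forall>B\<in>S. \<forall>C\<in>S. A \<inter> B = {} \<longrightarrow> B \<inter> C = {} \<longrightarrow> A \<inter> C \<noteq> {} \<longrightarrow> A = C) \<and>
    (\<forall>U \<in> pverts (kneser n 2) - S. \<exists>A\<in>S. \<exists>B\<in>S. U \<inter> A = {} \<and> A \<inter> B = {} \<and> U \<inter> B \<noteq> {})"
    (is "_ \<longleftrightarrow> ?sub \<and> ?free \<and> ?reach")
proof
  assume t: "terminal_set (with_proj (kneser n 2)) S"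
  then have "?sub \<and> ?free"
    using general_position_kneser_2_iff[OF assms] by (simp add: terminal_set_def)
  with t show "?sub \<and> ?free \<and> ?reach"
    using shortest_path_from_iff_kneser_2[OF assms, of S] by (simp add: terminal_set_def)
next
  assume r: "?sub \<and> ?free \<and> ?reach"
  have "\<not> S \<subset> T" if gp: "general_position (with_proj (kneser n 2)) T" for T
  proof
    assume "S \<subset> T"
    then obtain U where U: "U \<in> T" "U \<notin> S" "S \<subseteq> T" by blast
    with gp have "U \<in> pverts (kneser n 2) - S" by (auto simp: general_position_def)
    from r[THEN conjunct2, THEN conjunct2, rule_format, OF this]
    obtain A B where AB: "A \<in> S" "B \<in> S" "U \<inter> A = {}" "A \<inter> B = {}" "U \<inter> B \<noteq> {}"
      by (elim bexE conjE)
    have "A \<in> T" "B \<in> T" using U AB by auto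
    with U(1) AB gp[unfolded general_position_kneser_2_iff[OF assms],
        THEN conjunct2, rule_format, of U A B]
    have "U = B" by argo
    with U(2) AB(2) show False by simp
  qed
  moreover have "general_position (with_proj (kneser n 2)) S"
    unfolding general_position_kneser_2_iff[OF assms] using r by (elim conjE) (intro conjI)
  ultimately show "terminal_set (with_proj (kneser n 2)) S"
    using r shortest_path_from_iff_kneser_2[OF assms, of S] by (simp add: terminal_set_def)
qed

section \<open>Structure of terminal sets\<close>

lemma
  assumes "5 \<le> n" "terminal_set (with_proj (kneser n 2)) S"
  shows terminal_set_kneser_2_subset: "S \<subseteq> pverts (kneser n 2)"
    and terminal_set_kneser_2_free: "\<And>A B C. A \<in> S \<Longrightarrow> B \<in> S \<Longrightarrow> C \<in> S \<Longrightarrow>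
      A \<inter> B = {} \<Longrightarrow> B \<inter> C = {} \<Longrightarrow> A \<inter> C \<noteq> {} \<Longrightarrow> A = C"
    and terminal_set_kneser_2_reach: "\<And>U. U \<in> pverts (kneser n 2) \<Longrightarrow> U \<notin> S \<Longrightarrow>
      \<exists>A\<in>S. \<exists>B\<in>S. U \<inter> A = {} \<and> A \<inter> B = {} \<and> U \<inter> B \<noteq> {}"
proof -
  note t = assms(2)[unfolded terminal_set_kneser_2_iff[OF assms(1)]]
  show "S \<subseteq> pverts (kneser n 2)" by (rule t[THEN conjunct1])
  show "A = C" if "A \<in> S" "B \<in> S" "C \<in> S" "A \<inter> B = {}" "B \<inter> C = {}" "A \<inter> C \<noteq> {}" for A B C
    by (rule t[THEN conjunct2, THEN conjunct1, rule_format, OF that])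
  show "\<exists>A\<in>S. \<exists>B\<in>S. U \<inter> A = {} \<and> A \<inter> B = {} \<and> U \<inter> B \<noteq> {}"
    if "U \<in> pverts (kneser n 2)" "U \<notin> S" for U
    by (rule t[THEN conjunct2, THEN conjunct2, rule_format, OF DiffI[OF that]])
qed

text \<open>\<open>S\<close> cannot contain every vertex, and the two witnesses that reach a missing
  vertex are disjoint from each other.\<close>

lemma terminal_set_kneser_2_disjoint_pair:
  assumes "5 \<le> n" "terminal_set (with_proj (kneser n 2)) S"
  obtains A B where "A \<in> S" "B \<in> S" "A \<inter> B = {}"
proof -
  \<comment> \<open>These form an induced path, so one of them is missing from \<open>S\<close>; the
    point 5 exists because \<open>5 \<le> n\<close>.\<close>
  let ?A = "{1, 2} :: nat set" and ?B = "{3, 4} :: nat set" and ?C = "{1, 5} :: nat set"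
  have v: "{?A, ?B, ?C} \<subseteq> pverts (kneser n 2)" using assms(1) by (auto simp: pverts_kneser)
  have "?A \<inter> ?B = {}" "?B \<inter> ?C = {}" "?A \<inter> ?C \<noteq> {}" "?A \<noteq> ?C" by (auto simp: doubleton_eq_iff)
  then have "?A \<notin> S \<or> ?B \<notin> S \<or> ?C \<notin> S"
    using terminal_set_kneser_2_free[OF assms, of ?A ?B ?C] by argo
  with v obtain U where "U \<in> pverts (kneser n 2)" "U \<notin> S" by auto
  from terminal_set_kneser_2_reach[OF assms this] that show thesis by (elim bexE conjE)
qed

text \<open>One point in \<open>A\<close> and a different one in \<open>B\<close> already exhaust
  \<open>C\<close>.\<close>

lemma pair_meeting_two_disjoint:
  assumes "card C = 2" "A \<inter> B = {}" "C \<inter> A \<noteq> {}" "C \<inter> B \<noteq> {}"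
  shows "C \<subseteq> A \<union> B"
proof -
  obtain x y where "x \<in> C" "x \<in> A" "y \<in> C" "y \<in> B" using assms by blast
  moreover from this assms(2) have "x \<noteq> y" by blast
  ultimately show ?thesis using assms(1) by (auto simp: card_2_iff)
qed

text \<open>If all other members avoid \<open>A\<close>, transitivity through \<open>A\<close> makes
  \<open>S\<close> a matching. Otherwise some \<open>C\<close> meets \<open>A\<close> and confines
  every member to \<open>A \<union> B\<close>.\<close>

lemma terminal_set_kneser_2_cases:
  assumes n: "5 \<le> n" and t: "terminal_set (with_proj (kneser n 2)) S"
    and AB: "A \<in> S" "B \<in> S" "A \<inter> B = {}"
  shows "pairwise disjnt S \<or> S \<subseteq> Pow (A \<union> B)"
proof -
  note free = terminal_set_kneser_2_free[OF n t]
  show ?thesis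
  proof (cases "\<forall>C\<in>S. C \<noteq> A \<longrightarrow> C \<inter> A = {}")
    case True
    have "C \<inter> D = {}" if CD: "C \<in> S" "D \<in> S" "C \<noteq> D" for C D
    proof (cases "C = A \<or> D = A")
      case True
      with CD \<open>\<forall>C\<in>S. C \<noteq> A \<longrightarrow> C \<inter> A = {}\<close> show ?thesis by (auto simp: Int_commute)
    next
      case False
      with CD True have "C \<inter> A = {}" "A \<inter> D = {}" by (auto simp: Int_commute)
      with free[of C A D] CD AB show ?thesis by argo
    qed
    then show ?thesis by (auto simp: pairwise_def disjnt_def)
  next
    case False
    have card: "card X = 2" if "X \<in> S" for X
      using that terminal_set_kneser_2_subset[OF n t] by (auto simp: pverts_kneser)
    from False obtain C where C: "C \<in> S" "C \<noteq> A" "C \<inter> A \<noteq> {}" by blast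
    \<comment> \<open>Were \<open>D\<close> disjoint from \<open>X\<close>, the path
      \<open>X\<close>, \<open>D\<close>, \<open>A\<close> would violate general position.\<close>
    have meets: "X \<inter> D \<noteq> {}"
      if "X \<in> S" "X \<noteq> A" "X \<inter> A \<noteq> {}" "D \<in> S" "A \<inter> D = {}" for X D
      using free[of X D A] that AB(1) by (metis Int_commute)
    have "D \<subseteq> A \<union> B" if D: "D \<in> S" for D
    proof (cases "D \<inter> A = {}")
      case True
      show ?thesis
      proof (cases "D = B")
        \<comment> \<open>A third pair \<open>D\<close> disjoint from \<open>A\<close> would avoid
          \<open>B\<close> too, yet it has to meet \<open>C\<close>, which lies inside
          \<open>A \<union> B\<close>: a contradiction.\<close>
        case False
        with free[of D A B] D True AB have "D \<inter> B = {}" by argo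
        moreover have "C \<subseteq> A \<union> B"
          using C AB card meets by (intro pair_meeting_two_disjoint) auto
        moreover have "C \<inter> D \<noteq> {}" using meets[of C D] C D True by blast
        ultimately show ?thesis using True by blast
      qed simp
    next
      case False
      then show ?thesis
        using meets[of D B] D AB card pair_meeting_two_disjoint[of D A B] by (cases "D = A") auto
    qed
    then show ?thesis by blast
  qed
qed

section \<open>The case \<open>6 \<le> n\<close>\<close>

lemma card_terminal_set_kneser_2:
  assumes n: "6 \<le> n" and t: "terminal_set (with_proj (kneser n 2)) S"
  shows "card S = n div 2"
proof -
  have n5: "5 \<le> n" using n by simp
  have S: "\<And>X. X \<in> S \<Longrightarrow> X \<subseteq> {1..n} \<and> card X = 2"
    using terminal_set_kneser_2_subset[OF n5 t] by (auto simp: pverts_kneser)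
  then have US: "\<Union>S \<subseteq> {1..n}" by blast
  \<comment> \<open>Two points outside \<open>W\<close> would form a pair disjoint from every member
    of \<open>S\<close>, which then meets no second witness. The bound is applied to
    \<open>A \<union> B\<close> and to \<open>\<Union>S\<close>.\<close>
  have cover: "card W \<ge> n - 1" if W: "\<Union>S \<subseteq> W" "W \<subseteq> {1..n}" for W
  proof (rule ccontr)
    assume "\<not> card W \<ge> n - 1"
    moreover have "card ({1..n} - W) = n - card W"
      using W(2) by (subst card_Diff_subset) (auto intro: finite_subset)
    ultimately have "2 \<le> card ({1..n} - W)" by linarith
    then obtain U where U: "U \<subseteq> {1..n} - W" "card U = 2" by (rule obtain_subset_with_card_n)
    then have dis: "U \<inter> X = {}" if "X \<in> S" for X using that W(1) by blast
    from U(2) have "U \<noteq> {}" by auto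
    with dis have "U \<notin> S" by blast
    moreover from U have "U \<in> pverts (kneser n 2)" by (auto simp: pverts_kneser)
    ultimately show False using terminal_set_kneser_2_reach[OF n5 t, of U] dis by auto
  qed
  obtain A B where AB: "A \<in> S" "B \<in> S" "A \<inter> B = {}"
    using terminal_set_kneser_2_disjoint_pair[OF n5 t] .
  have "card (A \<union> B) \<le> 4" using card_Un_le[of A B] S AB by fastforce
  \<comment> \<open>Here \<open>6 \<le> n\<close> is decisive: four points are fewer than
    \<open>n - 1\<close>.\<close>
  then have "\<not> S \<subseteq> Pow (A \<union> B)" using cover[of "A \<union> B"] AB S n by fastforce
  then have "pairwise disjnt S" using terminal_set_kneser_2_cases[OF n5 t AB] by blast
  then have "card (\<Union>S) = sum card S"
    using S by (intro card_Union_disjoint) (auto intro: finite_subset)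
  also have "\<dots> = 2 * card S" using S by simp
  finally have "card (\<Union>S) = 2 * card S" .
  moreover have "card (\<Union>S) \<le> n" using card_mono[OF _ US] by simp
  moreover have "card (\<Union>S) \<ge> n - 1" using cover[of "\<Union>S"] US by blast
  \<comment> \<open>The even number \<open>2 * card S\<close> is \<open>n - 1\<close> or
    \<open>n\<close>.\<close>
  ultimately show ?thesis by linarith
qed

text \<open>The blocks {1,2}, {3,4}, ... form a matching that misses at most the point
  \<open>n\<close>.\<close>

lemma terminal_set_kneser_2_exists:
  assumes n: "6 \<le> n"
  shows "\<exists>S. terminal_set (with_proj (kneser n 2)) S"
proof -
  have n5: "5 \<le> n" using n by simp
  define e where "e i = {2 * i + 1, 2 * i + 2}" for i :: nat
  \<comment> \<open>The index of the block of \<open>x\<close> is \<open>(x - 1) div 2\<close>;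
    truncated subtraction would also put 0 into block 0, hence \<open>1 \<le> x\<close>.\<close>
  have e_iff: "x \<in> e i \<longleftrightarrow> 1 \<le> x \<and> (x - 1) div 2 = i" for x i by (auto simp: e_def)
  let ?S = "e ` {..<n div 2}"
  have sub: "?S \<subseteq> pverts (kneser n 2)" by (auto simp: pverts_kneser e_def)
  have free: "X = Y" if "X \<in> ?S" "Y \<in> ?S" "X \<inter> Y \<noteq> {}" for X Y using that by (auto simp: e_iff)
  have reach: "\<exists>A\<in>?S. \<exists>B\<in>?S. U \<inter> A = {} \<and> A \<inter> B = {} \<and> U \<inter> B \<noteq> {}"
    if U: "U \<in> pverts (kneser n 2)" for U
  proof -
    from U obtain x y where xy: "U = {x, y}" "x \<noteq> y" "x \<in> {1..n}" "y \<in> {1..n}"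
      by (auto simp: pverts_kneser card_2_iff)
    \<comment> \<open>Only \<open>n\<close>, for odd \<open>n\<close>, lies in no block, so one of
      the two points of \<open>U\<close> is covered.\<close>
    have "\<exists>z\<in>U. (z - 1) div 2 < n div 2"
    proof (rule ccontr)
      assume "\<not> ?thesis"
      then have "n div 2 \<le> (x - 1) div 2" "n div 2 \<le> (y - 1) div 2" using xy by auto
      with xy show False by auto
    qed
    then obtain z where z: "z \<in> U" "(z - 1) div 2 < n div 2" by blast
    \<comment> \<open>The points of \<open>U\<close> occupy at most two block indices, and
      \<open>6 \<le> n\<close> provides three blocks; the free one is the middle vertex of the path
      from \<open>U\<close>.\<close>
    have "\<exists>i<3. i \<noteq> (x - 1) div 2 \<and> i \<noteq> (y - 1) div 2" by presburger
    then obtain i where "i < 3" and i: "i \<noteq> (x - 1) div 2" "i \<noteq> (y - 1) div 2" by blast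
    have i_less: "i < n div 2" using \<open>i < 3\<close> n by linarith
    have "U \<inter> e i = {}" using i xy by (auto simp: e_iff)
    moreover have "e i \<inter> e ((z - 1) div 2) = {}" using i xy z by (auto simp: e_iff)
    moreover have "z \<in> U \<inter> e ((z - 1) div 2)" using z xy by (auto simp: e_iff)
    ultimately show ?thesis using i_less z(2) by blast
  qed
  have "terminal_set (with_proj (kneser n 2)) ?S"
    unfolding terminal_set_kneser_2_iff[OF n5] 
    by (intro conjI ballI impI sub) (use free reach in simp_all)
  then show ?thesis by blast
qed

section \<open>The case \<open>n = 5\<close>\<close>

lemma pair_complement_unique:
  assumes "card V = 4" "A \<subseteq> V" "card A = 2" "X \<subseteq> V" "card X = 2" "A \<inter> X = {}"
  shows "X = V - A"
proof (rule card_subset_eq)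
  have fin: "finite V" "finite A" using assms by (auto intro: card_ge_0_finite)
  then show "finite (V - A)" by simp
  show "X \<subseteq> V - A" using assms by blast
  show "card X = card (V - A)" using assms fin by (simp add: card_Diff_subset)
qed

text \<open>\<open>S\<close> consists of all pairs inside the four points
  \<open>A \<union> B\<close>, whence 6 = \<open>4 choose 2\<close>.\<close>

lemma card_terminal_set_kneser_5_2:
  assumes t: "terminal_set (with_proj (kneser 5 2)) S"
  shows "card S = 6"
proof -
  have S: "\<And>X. X \<in> S \<Longrightarrow> X \<subseteq> {1..5} \<and> card X = 2"
    using terminal_set_kneser_2_subset[OF order_refl t] by (auto simp: pverts_kneser)
  then have fin: "\<And>X. X \<in> S \<Longrightarrow> finite X" by (meson finite_atLeastAtMost finite_subset)
  obtain A B where AB: "A \<in> S" "B \<in> S" "A \<inter> B = {}"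
    using terminal_set_kneser_2_disjoint_pair[OF order_refl t] .
  let ?V = "A \<union> B"
  have V: "card ?V = 4" "?V \<subseteq> {1..5}" using AB S fin by (simp_all add: card_Un_disjoint)
  have "S \<subseteq> Pow ?V"
    using terminal_set_kneser_2_cases[OF order_refl t AB]
  proof
    assume pw: "pairwise disjnt S"
    show ?thesis
    proof
      fix C assume C: "C \<in> S"
      have "C = A \<or> C = B"
      proof (rule ccontr)
        assume "\<not> ?thesis"
        then have "?V \<inter> C = {}" using pw AB C by (auto simp: pairwise_def disjnt_def)
        \<comment> \<open>A third member of a matching would need a sixth point.\<close>
        then have "card (?V \<union> C) = 6" using V S[OF C] AB C fin by (simp add: card_Un_disjoint)
        moreover have "card (?V \<union> C) \<le> card {1..5::nat}"
          using V S[OF C] by (intro card_mono) auto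
        ultimately show False by simp
      qed
      then show "C \<in> Pow ?V" by blast
    qed
  qed
  moreover have "U \<in> S" if U: "U \<subseteq> ?V" "card U = 2" for U
  proof (rule ccontr)
    assume "U \<notin> S"
    have "U \<in> pverts (kneser 5 2)" using U V by (auto simp: pverts_kneser)
    from terminal_set_kneser_2_reach[OF order_refl t this \<open>U \<notin> S\<close>]
    obtain C D where CD: "C \<in> S" "D \<in> S" "U \<inter> C = {}" "C \<inter> D = {}" by (elim bexE conjE)
    then have sub: "C \<subseteq> ?V" "D \<subseteq> ?V" using \<open>S \<subseteq> Pow ?V\<close> by blast+
    \<comment> \<open>Both \<open>U\<close> and \<open>D\<close> are the complement of
      \<open>C\<close> in \<open>?V\<close>, so \<open>U = D\<close> lies in \<open>S\<close> after
      all.\<close>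
    have "U = ?V - C"
      using pair_complement_unique[OF V(1) sub(1) _ U] S[OF CD(1)] CD(3) by (simp add: Int_commute)
    moreover have "D = ?V - C"
      using pair_complement_unique[OF V(1) sub(1) _ sub(2)] S CD by simp
    ultimately show False using CD(2) \<open>U \<notin> S\<close> by simp
  qed
  ultimately have "S = {X. X \<subseteq> ?V \<and> card X = 2}" using S by blast
  moreover have "finite ?V" using V by (intro card_ge_0_finite) simp
  ultimately have "card S = 4 choose 2" using n_subsets[of ?V 2] V by simp
  then show ?thesis by (simp add: numeral_eq_Suc)
qed

text \<open>The six pairs in {1,...,4} work: disjointness there only matches each pair with its
  complement.\<close>

lemma terminal_set_kneser_5_2_exists: "\<exists>S. terminal_set (with_proj (kneser 5 2)) S"
proof -
  let ?V = "{1..4} :: nat set"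
  let ?S = "{X. X \<subseteq> ?V \<and> card X = 2}"
  have V: "card ?V = 4" by simp
  have sub: "?S \<subseteq> pverts (kneser 5 2)" by (auto simp: pverts_kneser)
  have free: "A = C" if "A \<in> ?S" "B \<in> ?S" "C \<in> ?S" "A \<inter> B = {}" "B \<inter> C = {}" for A B C
    using that pair_complement_unique[OF V, of B A] pair_complement_unique[OF V, of B C]
    by (auto simp: Int_commute)
  have reach: "\<exists>A\<in>?S. \<exists>B\<in>?S. U \<inter> A = {} \<and> A \<inter> B = {} \<and> U \<inter> B \<noteq> {}"
    if U: "U \<in> pverts (kneser 5 2) - ?S" for U
  proof -
    have U2: "U \<subseteq> {1..5}" "card U = 2" "\<not> U \<subseteq> ?V" using U by (auto simp: pverts_kneser)
    then obtain w where "w \<in> U" "w \<in> {1..5}" "w \<notin> ?V" by blast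
    then have "5 \<in> U" by (cases "w = 5") auto
    with U2 obtain x where x: "U = {5, x}" "x \<noteq> 5" by (auto simp: card_2_iff)
    with U2 have xV: "x \<in> ?V" by auto
    then have "1 \<le> card (?V - {x})" by simp
    then obtain y where y: "y \<in> ?V" "y \<noteq> x" by (metis Diff_iff card.empty ex_in_conv insertI1 not_one_le_zero)
    \<comment> \<open>The path is \<open>U\<close>, \<open>?V - ?B\<close>, \<open>?B\<close>:
      removing \<open>x\<close> from the middle pair keeps it away from \<open>U\<close>, whose
      other point 5 is outside \<open>?V\<close>.\<close>
    let ?B = "{x, y}"
    have "?B \<in> ?S" "?V - ?B \<in> ?S" using xV y by (auto simp: card_Diff_subset)
    moreover have "U \<inter> (?V - ?B) = {}" "(?V - ?B) \<inter> ?B = {}" "U \<inter> ?B \<noteq> {}" using x by auto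
    ultimately show ?thesis by blast
  qed
  have "terminal_set (with_proj (kneser 5 2)) ?S"
    unfolding terminal_set_kneser_2_iff[OF order_refl]
    by (intro conjI ballI impI sub) (rule free reach; assumption)+
  then show ?thesis by blast
qed

section \<open>Evaluation of \<open>tp\<close> and \<open>tp_minus\<close>\<close>

text \<open>Existence makes the set of orders the singleton \<open>{m}\<close> rather than empty, so
  \<open>Max\<close> and \<open>Min\<close> are determined.\<close>

lemma tp_eqI:
  assumes "\<exists>S. terminal_set G S" "\<And>S. terminal_set G S \<Longrightarrow> card S = m"
  shows "tp G = m" "tp_minus G = m"
proof -
  have "{card S | S. terminal_set G S} = {m}" using assms by auto
  then show "tp G = m" "tp_minus G = m" by (simp_all add: tp_def tp_minus_def)
qed

theorem theorem4p2:
  fixes n :: nat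
  assumes "n \<ge> 5"
  shows "(n = 5 \<longrightarrow> tp (with_proj (kneser n 2)) = 6 \<and> tp_minus (with_proj (kneser n 2)) = 6) \<and>
         (n \<ge> 6 \<longrightarrow> tp (with_proj (kneser n 2)) = n div 2 \<and>
                    tp_minus (with_proj (kneser n 2)) = n div 2)"
  by (auto intro: tp_eqI terminal_set_kneser_5_2_exists card_terminal_set_kneser_5_2
      terminal_set_kneser_2_exists card_terminal_set_kneser_2)

end
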